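(* Let $(P_n)_{n\ge1}$ be i.i.d. random variables in $[0,1]$, and let $G_n$ be the (random) empirical distribution of the break points of the split-merge dynamics with splitting proportions $P_{n,k}=P_n$ for all $1\le k\le n$ (random stratified case). Set $$s=\mathbb{E}(P_1(1-P_1))$$ and assume that $\mathbb{P}(P_1\in(0,1))>0$. Then, almost surely, the sequence $(\sqrt n\,G_n/\sqrt s)$ of Radon measures on $(0,1)$ converges vaguely on $(0,1)$ to the Radon measure with density $Q'$ with respect to Lebesgue measure.
   Context: Given random splitting proportions $(P_{n,k}:n\ge1,\ 1\le k\le n)$ in $[0,1]$, the break points of the split-merge dynamics are defined by $A_{n,0}=0$, $A_{n,n+1}=1$ for all $n\ge0$, and recursively for $n\ge1$, $$A_{n,k}=P_{n,k}\,A_{n-1,k-1}+(1-P_{n,k})\,A_{n-1,k},\qquad k=1,\dots,n.$$ The empirical distribution of the break points is $G_n=\frac1n\sum_{k=1}^n\delta_{A_{n,k}}$ for $n\ge1$, where $\delta_a$ is the unit mass at $a$; here it is restricted to $(0,1)$. $Q=\Phi^{-1}:(0,1)\to\mathbb{R}$ is the quantile function of the standard normal distribution, where $\Phi$ is the standard normal cumulative distribution function. Vague convergence on $(0,1)$ means convergence of integrals of every continuous function with compact support in $(0,1)$. *)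

theory Defs
  imports "HOL-Probability.Probability"
begin

text \<open>Break points \<open>A n k\<close> (\<open>0 \<le> k \<le> n + 1\<close>) driven by splitting proportions \<open>p n k\<close>
  (\<open>1 \<le> k \<le> n\<close>). The value for \<open>k > n + 1\<close> is a dummy, never used by the recursion in the
  range \<open>0 \<le> k \<le> n + 1\<close>.\<close>

fun break_point :: "(nat \<Rightarrow> nat \<Rightarrow> real) \<Rightarrow> nat \<Rightarrow> nat \<Rightarrow> real" where
  "break_point p n 0 = 0"
| "break_point p 0 (Suc k) = 1"
| "break_point p (Suc n) (Suc k) =
     (if k \<le> n
      then p (Suc n) (Suc k) * break_point p n k
           + (1 - p (Suc n) (Suc k)) * break_point p n (Suc k)
      else 1)"

lemma break_point_last: "break_point p n (n + 1) = 1"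
  by (cases n) auto

lemma break_point_rec:
  assumes "1 \<le> n" "1 \<le> k" "k \<le> n"
  shows "break_point p n k =
    p n k * break_point p (n - 1) (k - 1) + (1 - p n k) * break_point p (n - 1) k"
  using assms by (cases n; cases k) auto

text \<open>The image of the uniform distribution on the index set \<open>{1..n}\<close>; this is
  \<open>1/n \<Sum>\<^sub>k \<delta>\<^bsub>A n k\<^esub>\<close> for \<open>n \<ge> 1\<close> (see the lemma below), restricted to the open unit
  interval. For \<open>n = 0\<close> it is the zero measure.\<close>

definition emp_break :: "(nat \<Rightarrow> nat \<Rightarrow> real) \<Rightarrow> nat \<Rightarrow> real measure" where
  "emp_break p n =
     restrict_space (distr (uniform_count_measure {1..n}) borel (break_point p n)) {0<..<1}"

lemma emeasure_emp_break:
  assumes "1 \<le> n" "B \<in> sets borel" "B \<subseteq> {0<..<1}"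
  shows "emeasure (emp_break p n) B =
    ennreal (1 / real n * (\<Sum>k = 1..n. indicator B (break_point p n k)))"
proof -
  have m: "break_point p n \<in> measurable (uniform_count_measure {1..n}) borel"
    by (simp add: measurable_def space_uniform_count_measure sets_uniform_count_measure
        Pow_def vimage_def subset_iff)
  have "emeasure (emp_break p n) B =
      emeasure (uniform_count_measure {1..n}) (break_point p n -` B \<inter> {1..n})"
    using assms m
    by (simp add: emp_break_def emeasure_restrict_space emeasure_distr
        space_uniform_count_measure)
  also have "\<dots> = ennreal (real (card (break_point p n -` B \<inter> {1..n})) / real n)"
    by (subst emeasure_uniform_count_measure) auto
  also have "real (card (break_point p n -` B \<inter> {1..n}))
      = (\<Sum>k = 1..n. indicator B (break_point p n k))"
    by (simp add: indicator_def sum.If_cases vimage_def Int_def conj_commute)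
  finally show ?thesis by simp
qed

text \<open>A Radon measure on a locally compact, second countable \<open>S\<close> (such as an open interval):
  a Borel measure on the subspace \<open>S\<close> that is finite on compact subsets.\<close>

definition radon_measure_on :: "'b::topological_space set \<Rightarrow> 'b measure \<Rightarrow> bool" where
  "radon_measure_on S \<mu> \<longleftrightarrow>
     sets \<mu> = sets (restrict_space borel S) \<and>
     (\<forall>K. compact K \<and> K \<subseteq> S \<longrightarrow> emeasure \<mu> K < \<infinity>)"

text \<open>Requiring all measures to be Radon makes every integral below that of an integrable
  function, so that no default value of the Bochner integral can enter.\<close>

definition vague_conv_on ::
  "'b::t2_space set \<Rightarrow> (nat \<Rightarrow> 'b measure) \<Rightarrow> 'b measure \<Rightarrow> bool" where
  "vague_conv_on S \<mu>s \<mu> \<longleftrightarrow>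
     (\<forall>n. radon_measure_on S (\<mu>s n)) \<and> radon_measure_on S \<mu> \<and>
     (\<forall>f :: 'b \<Rightarrow> real.
        continuous_on S f \<and> compact (closure {x \<in> S. f x \<noteq> 0})
        \<and> closure {x \<in> S. f x \<noteq> 0} \<subseteq> S
        \<longrightarrow> (\<lambda>n. \<integral>x. f x \<partial>\<mu>s n) \<longlonglongrightarrow> (\<integral>x. f x \<partial>\<mu>))"

definition Phi :: "real \<Rightarrow> real" where
  "Phi = cdf std_normal_distribution"

text \<open>Only meaningful on the open unit interval, the range of the injective function \<open>Phi\<close>.\<close>

definition Q :: "real \<Rightarrow> real" where
  "Q = inv Phi"

end

theory Submission
  imports Defs "HOL-Real_Asymp.Real_Asymp"
begin

text \<open>
  Fix a realization \<open>q i = P\<^sub>i(\<omega>)\<close> of the proportions and let \<open>S\<^sub>n\<close> be a sum of \<open>n\<close> independent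
  Bernoulli variables with success probabilities \<open>q 1, \<dots>, q n\<close>. Conditioning on the last of
  them gives exactly the recursion of the break points, so \<open>A\<^bsub>n,k\<^esub>\<close> is the probability of
  \<open>S\<^sub>n < k\<close> (lemma \<open>break_point_eq_poisson_binomial\<close>): the break points are the values of the
  distribution function of \<open>S\<^sub>n\<close>.

  The variance of \<open>S\<^sub>n\<close> is \<open>\<Sum>\<^sub>i q i * (1 - q i)\<close>, which by the strong law of large numbers is
  asymptotically \<open>n s\<close> for almost every realization, and \<open>s > 0\<close> by nondegeneracy. For such a
  realization the central limit theorem \<open>poisson_binomial_clt\<close> holds: the distribution function
  \<open>F\<^sub>n\<close> of \<open>(S\<^sub>n - E S\<^sub>n) / sqrt (n s)\<close> converges pointwise to \<open>Phi\<close>. The trials are not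
  identically distributed, and it is proved with characteristic functions.

  Now \<open>F\<^sub>n\<close> is a step function whose steps have length \<open>1 / sqrt (n s)\<close> and whose values are the
  break points. Therefore the integral of a test function \<open>f\<close> against \<open>sqrt n G\<^sub>n / sqrt s\<close>, which
  is \<open>(\<Sum>\<^sub>k f A\<^bsub>n,k\<^esub>) / sqrt (n s)\<close>, equals the Lebesgue integral of \<open>f (F\<^sub>n x)\<close> over the
  line (lemma \<open>sum_break_points_eq_integral\<close>). Since \<open>f\<close> vanishes near 0 and 1 and \<open>F\<^sub>n\<close> is
  monotone, the integrands are eventually supported in a common compact interval, and dominated
  convergence gives the limit \<open>\<integral> f (Phi x) dx\<close> (lemma \<open>scaled_sum_tendsto\<close>). The substitution
  \<open>x = Q y\<close> turns it into \<open>\<integral> f y * Q' y dy\<close> (lemma \<open>integral_compose_Phi\<close>).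
\<close>

section \<open>A strong law of large numbers for bounded variables\<close>

text \<open>Boundedness makes the deviation probabilities decay geometrically by Hoeffding's inequality,
  hence summably, and the Borel--Cantelli lemma applies for each tolerance \<open>\<epsilon>\<close>. Letting \<open>\<epsilon>\<close> run
  through a sequence decreasing to 0 keeps the exceptional set null.\<close>

lemma (in prob_space) strong_law_bounded_iid:
  fixes X :: "nat \<Rightarrow> 'a \<Rightarrow> real"
  assumes indep: "indep_vars (\<lambda>_. borel) X {1..}"
    and ident: "\<And>n. n \<ge> 1 \<Longrightarrow> distr M borel (X n) = distr M borel (X 1)"
    and bound: "AE \<omega> in M. X 1 \<omega> \<in> {a..b}" and ab: "a < b"
  shows "AE \<omega> in M. (\<lambda>n. (\<Sum>i=1..n. X i \<omega>) / real n) \<longlonglongrightarrow> expectation (X 1)"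
proof -
  have [measurable]: "X i \<in> borel_measurable M" if "i \<ge> 1" for i
    using indep that unfolding indep_vars_def by auto
  let ?\<mu> = "expectation (X 1)"
  have dev: "AE \<omega> in M. \<forall>\<^sub>F n in sequentially. \<bar>(\<Sum>i=1..n. X i \<omega>) / real n - ?\<mu>\<bar> < \<epsilon>"
    if \<epsilon>: "\<epsilon> > 0" for \<epsilon> :: real
  proof -
    define A where "A n = {\<omega> \<in> space M. \<bar>(\<Sum>i=1..n. X i \<omega>) / real n - ?\<mu>\<bar> \<ge> \<epsilon>}" for n
    define r where "r = exp (-2 * \<epsilon>\<^sup>2 / (b - a)\<^sup>2)"
    have meas: "A n \<in> sets M" for n
    proof -
      have "(\<lambda>\<omega>. \<Sum>i=1..n. X i \<omega>) \<in> borel_measurable M"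
        by (rule borel_measurable_sum) auto
      then show ?thesis unfolding A_def by measurable
    qed
    have le: "prob (A n) \<le> 2 * r ^ n" for n
    proof (cases "n = 0")
      case True
      then show ?thesis by (simp add: order_trans[OF prob_le_1])
    next
      case False
      have H: "Hoeffding_ineq_iid M {1..n} X (X 1) a b"
      proof unfold_locales
        show "indep_vars (\<lambda>_. borel) X {1..n}" by (rule indep_vars_subset[OF indep]) auto
        show "AE x in M. X 1 x \<in> {a..b}" by (rule bound)
        show "distr M borel (X i) = distr M borel (X 1)" if "i \<in> {1..n}" for i
          by (rule ident) (use that in simp)
        show "finite {1..n}" by (rule finite_atLeastAtMost)
        show "X 1 \<in> borel_measurable M" by measurable
      qed
      have "prob (A n) \<le> 2 * exp (-2 * real n * \<epsilon>\<^sup>2 / (b - a)\<^sup>2)"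
        using Hoeffding_ineq_iid.Hoeffding_ineq_abs_ge'[OF H, of \<epsilon>] \<epsilon> ab False by (simp add: A_def)
      also have "exp (-2 * real n * \<epsilon>\<^sup>2 / (b - a)\<^sup>2) = r ^ n"
        unfolding r_def exp_of_nat_mult[symmetric] by (simp add: field_simps)
      finally show ?thesis .
    qed
    have "r < 1" unfolding r_def using \<epsilon> ab by simp
    then have "summable (\<lambda>n. 2 * r ^ n)"
      by (intro summable_mult summable_geometric) (simp add: r_def)
    then have "summable (\<lambda>n. prob (A n))"
      by (rule summable_comparison_test') (use le in simp)
    from borel_cantelli_AE1[OF meas _ this]
    have "AE \<omega> in M. \<forall>\<^sub>F n in sequentially. \<omega> \<in> space M - A n"
      by (simp add: less_top[symmetric])
    then show ?thesis
      by eventually_elim (auto elim!: eventually_mono simp: A_def not_le)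
  qed
  have "AE \<omega> in M. \<forall>k. \<forall>\<^sub>F n in sequentially.
      \<bar>(\<Sum>i=1..n. X i \<omega>) / real n - ?\<mu>\<bar> < inverse (real (Suc k))"
    unfolding AE_all_countable by (intro allI dev) simp
  then show ?thesis
  proof eventually_elim
    case (elim \<omega>)
    show ?case
    proof (rule tendstoI)
      fix e :: real assume "e > 0"
      then obtain k where "inverse (real (Suc k)) < e"
        using reals_Archimedean by blast
      with elim[rule_format, of k]
      show "\<forall>\<^sub>F n in sequentially. dist ((\<Sum>i=1..n. X i \<omega>) / real n) ?\<mu> < e"
        by (auto elim!: eventually_mono simp: dist_real_def)
    qed
  qed
qed

section \<open>The standard normal quantile function\<close>

lemma Phi_eq_integral:
  assumes "a \<le> x"
  shows "Phi x = Phi a + integral {a..x} std_normal_density"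
proof (cases "a = x")
  case False
  then have ax: "a < x" using assms by simp
  interpret real_distribution std_normal_distribution by (rule real_dist_normal_dist)
  have int: "set_integrable lborel {a..x} std_normal_density"
    by (rule borel_integrable_atLeastAtMost')
      (auto simp: std_normal_density_def intro!: continuous_intros)
  have "Phi x - Phi a = measure std_normal_distribution {a<..x}"
    unfolding Phi_def using cdf_diff_eq[OF ax] .
  also have "\<dots> = (\<integral>y. indicator {a<..x} y \<partial>std_normal_distribution)"
    by simp
  also have "\<dots> = (LINT y:{a<..x}|lborel. std_normal_density y)"
    by (subst integral_density) (auto simp: set_lebesgue_integral_def mult.commute)
  also have "\<dots> = (LINT y:{a..x}|lborel. std_normal_density y)"
    by (rule set_integral_discrete_difference[where X="{a}"]) auto
  also have "\<dots> = integral {a..x} std_normal_density"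
    using int by (rule set_borel_integral_eq_integral)
  finally show ?thesis by simp
qed simp

lemma Phi_has_real_derivative: "(Phi has_real_derivative std_normal_density x) (at x)"
proof -
  let ?I = "{x - 1<..<x + 1}"
  \<comment> \<open>The base point \<open>x - 1\<close> only has to lie to the left of a neighbourhood of \<open>x\<close>.\<close>
  have "((\<lambda>y. integral {x - 1..y} std_normal_density) has_real_derivative std_normal_density x)
      (at x within {x - 1..x + 1})"
    by (rule integral_has_real_derivative)
      (auto simp: std_normal_density_def intro!: continuous_intros)
  then have "((\<lambda>y. integral {x - 1..y} std_normal_density) has_real_derivative std_normal_density x)
      (at x within ?I)"
    by (rule DERIV_subset) auto
  then have "((\<lambda>y. Phi (x - 1) + integral {x - 1..y} std_normal_density)
      has_real_derivative std_normal_density x) (at x within ?I)"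
    by (auto intro!: derivative_eq_intros)
  then have "(Phi has_real_derivative std_normal_density x) (at x within ?I)"
    by (rule has_field_derivative_transform_within[where d=1])
      (auto simp: Phi_eq_integral[of "x - 1", symmetric])
  then show ?thesis
    by (simp add: at_within_open[of x ?I])
qed

lemma isCont_Phi: "isCont Phi x"
  using Phi_has_real_derivative by (rule DERIV_isCont)

lemma strict_mono_Phi: "strict_mono Phi"
proof (rule strict_monoI)
  fix x y :: real assume "x < y"
  then show "Phi x < Phi y"
    by (rule DERIV_pos_imp_increasing)
      (use Phi_has_real_derivative normal_density_pos[of 1] in auto)
qed

lemma Phi_less_iff [simp]: "Phi x < Phi y \<longleftrightarrow> x < y"
  using strict_mono_Phi by (rule strict_mono_less)

lemma Phi_le_iff [simp]: "Phi x \<le> Phi y \<longleftrightarrow> x \<le> y"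
  using strict_mono_Phi by (rule strict_mono_less_eq)

lemma Phi_at_top: "(Phi \<longlongrightarrow> 1) at_top"
  unfolding Phi_def by (rule real_distribution.cdf_lim_at_top_prob[OF real_dist_normal_dist])

lemma Phi_at_bot: "(Phi \<longlongrightarrow> 0) at_bot"
proof -
  interpret real_distribution std_normal_distribution by (rule real_dist_normal_dist)
  show ?thesis unfolding Phi_def by (rule cdf_lim_at_bot)
qed

lemma Q_Phi: "Q (Phi x) = x"
  unfolding Q_def by (simp add: inv_f_f strict_mono_Phi strict_mono_imp_inj_on)

lemma Phi_Q:
  assumes "0 < y" "y < 1"
  shows "Phi (Q y) = y"
proof -
  obtain a where a: "Phi a < y"
    using order_tendstoD(2)[OF Phi_at_bot assms(1)]
    by (auto dest: eventually_happens'[OF trivial_limit_at_bot_linorder])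
  obtain b where b: "y < Phi b"
    using order_tendstoD(1)[OF Phi_at_top assms(2)]
    by (auto dest: eventually_happens'[OF trivial_limit_at_top_linorder])
  have "Phi a < Phi b" using a b by (rule less_trans)
  then have "a \<le> b" by simp
  then have "\<exists>x. a \<le> x \<and> x \<le> b \<and> Phi x = y"
    using a b isCont_Phi by (intro IVT) auto
  then show ?thesis using Q_Phi by auto
qed

lemma isCont_Q:
  assumes "0 < y" "y < 1"
  shows "isCont Q y"
proof -
  have "isCont Q (Phi (Q y))"
    by (rule isCont_inverse_function2[where a="Q y - 1" and b="Q y + 1"])
      (auto simp: Q_Phi isCont_Phi)
  then show ?thesis by (simp add: Phi_Q assms)
qed

lemma Q_has_real_derivative:
  assumes "0 < y" "y < 1"
  shows "(Q has_real_derivative inverse (std_normal_density (Q y))) (at y)"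
  by (rule DERIV_inverse_function[where f=Phi and a=0 and b=1])
    (use assms Phi_has_real_derivative normal_density_pos[of 1 0 "Q y"]
      in \<open>auto simp: Phi_Q isCont_Q\<close>)

lemma deriv_Q:
  assumes "0 < y" "y < 1"
  shows "deriv Q y = inverse (std_normal_density (Q y))"
  using Q_has_real_derivative[OF assms] by (rule DERIV_imp_deriv)

lemma deriv_Q_nonneg: "0 < y \<Longrightarrow> y < 1 \<Longrightarrow> 0 \<le> deriv Q y"
  by (simp add: deriv_Q)

lemma continuous_on_deriv_Q: "continuous_on {0<..<1} (deriv Q)"
proof -
  have "continuous_on {0<..<1} Q"
    by (rule continuous_at_imp_continuous_on) (auto intro: isCont_Q)
  then have "continuous_on {0<..<1} (\<lambda>y. inverse (std_normal_density (Q y)))"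
    unfolding std_normal_density_def by (auto intro!: continuous_intros)
  then show ?thesis
    by (rule continuous_on_eq) (auto simp: deriv_Q)
qed

text \<open>Substitution \<open>x = Q y\<close>. It is performed for \<open>y\<close> in \<open>{a..b}\<close> only, where
  \<open>Q\<close> is continuously differentiable; outside, both integrands vanish.
  In this form \<open>Q'\<close> appears as the density of the image of Lebesgue measure under \<open>Phi\<close>.\<close>

lemma integral_compose_Phi:
  fixes f :: "real \<Rightarrow> real"
  assumes cont: "continuous_on UNIV f" and ab: "0 < a" "a \<le> b" "b < 1"
    and supp: "\<And>y. y \<notin> {a..b} \<Longrightarrow> f y = 0"
  shows "(\<integral>x. f (Phi x) \<partial>lborel) = (\<integral>y. f y * deriv Q y \<partial>lborel)"
proof -
  have Phi_cont: "continuous_on A Phi" for A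
    by (rule continuous_at_imp_continuous_on) (auto intro: isCont_Phi)
  have int: "set_integrable lborel {Q a..Q b} (\<lambda>x. f (Phi x))"
    by (rule borel_integrable_atLeastAtMost')
      (auto intro!: continuous_on_compose2[OF cont] Phi_cont)
  have "(\<integral>x. f (Phi x) \<partial>lborel) = (\<integral>x. f (Phi x) * indicator {Q a..Q b} x \<partial>lborel)"
  proof (rule Bochner_Integration.integral_cong[OF refl])
    fix x
    have "Phi x \<notin> {a..b}" if "x \<notin> {Q a..Q b}"
      using that ab Phi_le_iff[of "Q a" x] Phi_le_iff[of x "Q b"]
      by (auto simp: Phi_Q simp del: Phi_le_iff)
    then show "f (Phi x) = f (Phi x) * indicator {Q a..Q b} x"
      using supp by (auto simp: indicator_def)
  qed
  also have "\<dots> = (\<integral>y. f (Phi (Q y)) * deriv Q y * indicator {a..b} y \<partial>lborel)"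
  proof (rule integral_substitution(2)[where g=Q and a=a and b=b, OF int])
    show "(Q has_real_derivative deriv Q y) (at y)" if "y \<in> {a..b}" for y
      using that ab Q_has_real_derivative[of y] by (simp add: deriv_Q)
    show "continuous_on {a..b} (deriv Q)"
      by (rule continuous_on_subset[OF continuous_on_deriv_Q]) (use ab in auto)
  qed (use ab in \<open>auto intro: deriv_Q_nonneg\<close>)
  also have "\<dots> = (\<integral>y. f y * deriv Q y \<partial>lborel)"
    by (rule Bochner_Integration.integral_cong[OF refl])
      (use ab supp in \<open>auto simp: indicator_def Phi_Q\<close>)
  finally show ?thesis .
qed

section \<open>Poisson-binomial distributions and their central limit theorem\<close>

text \<open>The law of \<open>S\<^sub>n\<close>, the number of successes in independent trials \<open>1, \<dots>, n\<close> with success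
  probabilities \<open>q i\<close>. Defining it by conditioning on the last trial makes its recursion
  literally that of the break points.\<close>

primrec poisson_binomial_pmf :: "(nat \<Rightarrow> real) \<Rightarrow> nat \<Rightarrow> nat pmf" where
  "poisson_binomial_pmf q 0 = return_pmf 0"
| "poisson_binomial_pmf q (Suc n) =
     bind_pmf (bernoulli_pmf (q (Suc n)))
       (\<lambda>b. map_pmf (\<lambda>j. of_bool b + j) (poisson_binomial_pmf q n))"

lemma finite_set_poisson_binomial_pmf [simp]: "finite (set_pmf (poisson_binomial_pmf q n))"
  by (induction n) (auto simp: set_bind_pmf)

lemma expectation_poisson_binomial_Suc:
  fixes h :: "nat \<Rightarrow> 'b::{banach, second_countable_topology}"
  assumes "0 \<le> q (Suc n)" "q (Suc n) \<le> 1"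
  shows "measure_pmf.expectation (poisson_binomial_pmf q (Suc n)) h =
    q (Suc n) *\<^sub>R measure_pmf.expectation (poisson_binomial_pmf q n) (\<lambda>j. h (Suc j)) +
    (1 - q (Suc n)) *\<^sub>R measure_pmf.expectation (poisson_binomial_pmf q n) h"
  unfolding poisson_binomial_pmf.simps
  by (subst pmf_expectation_bind[of UNIV]) (use assms in \<open>auto simp: UNIV_bool\<close>)

text \<open>The recursion of the break points in the stratified case is the law of total probability
  for \<open>S\<^bsub>n + 1\<^esub> < k\<close>, conditioned on trial \<open>n + 1\<close>: a success leaves \<open>S\<^sub>n < k - 1\<close>,
  a failure leaves \<open>S\<^sub>n < k\<close>.\<close>

lemma break_point_eq_poisson_binomial:
  assumes q: "q \<in> {1..} \<rightarrow> {0..1}" and "k \<le> n + 1"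
  shows "break_point (\<lambda>n k. q n) n k = measure_pmf.prob (poisson_binomial_pmf q n) {..<k}"
  using \<open>k \<le> n + 1\<close>
proof (induction n arbitrary: k)
  case 0
  then show ?case by (cases k) (auto simp: measure_return_pmf)
next
  case (Suc n)
  have E: "measure_pmf.prob (poisson_binomial_pmf q m) A =
      measure_pmf.expectation (poisson_binomial_pmf q m) (indicator A)" for m A
    by simp
  have q': "0 \<le> q (Suc n)" "q (Suc n) \<le> 1" using funcset_mem[OF q, of "Suc n"] by auto
  show ?case
  proof (cases k)
    case 0
    then show ?thesis by simp
  next
    case k: (Suc k')
    have shift: "(\<lambda>j. indicator {..<Suc k'} (Suc j) :: real) = indicator {..<k'}"
      by (auto simp: indicator_def)
    have rec: "measure_pmf.prob (poisson_binomial_pmf q (Suc n)) {..<k} =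
        q (Suc n) * measure_pmf.prob (poisson_binomial_pmf q n) {..<k'} +
        (1 - q (Suc n)) * measure_pmf.prob (poisson_binomial_pmf q n) {..<k}"
      using q' by (simp add: E k shift expectation_poisson_binomial_Suc del: poisson_binomial_pmf.simps
          Bochner_Integration.integral_indicator)
    show ?thesis
    proof (cases "k' \<le> n")
      case True
      then show ?thesis using Suc.IH[of k'] Suc.IH[of k] rec by (simp add: k)
    next
      \<comment> \<open>The boundary value \<open>k = n + 2\<close> is not covered by the recursion: here the event is certain.\<close>
      case False
      then have k': "k' = Suc n" using Suc.prems k by simp
      have one: "measure_pmf.prob (poisson_binomial_pmf q n) {..<Suc n} = 1"
        using Suc.IH[of "Suc n"] break_point_last[of "\<lambda>n k. q n" n] by simp
      have "measure_pmf.prob (poisson_binomial_pmf q n) {..<j} = 1" if "j \<ge> Suc n" for j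
        using measure_pmf.finite_measure_mono[of "{..<Suc n}" "{..<j}" "poisson_binomial_pmf q n"]
          that one measure_pmf.prob_le_1[of "poisson_binomial_pmf q n" "{..<j}"] by auto
      then show ?thesis using rec k k' by simp
    qed
  qed
qed

lemma poisson_binomial_char:
  assumes q: "q \<in> {1..} \<rightarrow> {0..1}"
  shows "measure_pmf.expectation (poisson_binomial_pmf q n) (\<lambda>j. iexp (u * (real j - sum q {1..n}))) =
    (\<Prod>i=1..n. complex_of_real (q i) * iexp (u * (1 - q i)) +
      complex_of_real (1 - q i) * iexp (u * (- q i)))"
proof (induction n)
  case 0
  then show ?case by simp
next
  case (Suc n)
  let ?\<nu> = "poisson_binomial_pmf q n" and ?m = "sum q {1..n}" and ?p = "q (Suc n)"
  have q': "0 \<le> q (Suc n)" "q (Suc n) \<le> 1" using funcset_mem[OF q, of "Suc n"] by auto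
  have split: "iexp (u * (real j + d - (?m + ?p))) = iexp (u * (real j - ?m)) * iexp (u * (d - ?p))" for j d
    by (simp add: exp_add[symmetric] algebra_simps)
  have "measure_pmf.expectation (poisson_binomial_pmf q (Suc n))
      (\<lambda>j. iexp (u * (real j - sum q {1..Suc n}))) =
    ?p *\<^sub>R measure_pmf.expectation ?\<nu> (\<lambda>j. iexp (u * (real j + 1 - (?m + ?p)))) +
    (1 - ?p) *\<^sub>R measure_pmf.expectation ?\<nu> (\<lambda>j. iexp (u * (real j + 0 - (?m + ?p))))"
    using q' by (subst expectation_poisson_binomial_Suc) (auto simp: add_ac)
  also have "\<dots> = measure_pmf.expectation ?\<nu> (\<lambda>j. iexp (u * (real j - ?m))) *
      (?p *\<^sub>R iexp (u * (1 - ?p)) + (1 - ?p) *\<^sub>R iexp (u * (0 - ?p)))"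
    unfolding split by (simp only: integral_mult_left_zero) (simp add: scaleR_conv_of_real algebra_simps)
  finally show ?case
    unfolding Suc.IH by (simp add: scaleR_conv_of_real)
qed

text \<open>Second-order Taylor expansion of the characteristic function of a centred Bernoulli variable:
  the linear terms cancel by centring, the quadratic ones combine to the variance
  \<open>p * (1 - p)\<close>, and the remainder of each exponential is at most \<open>\<bar>u\<bar> ^ 3 / 6\<close>.\<close>

lemma bernoulli_char_bound:
  fixes p u :: real
  assumes p: "0 \<le> p" "p \<le> 1"
  shows "cmod (complex_of_real p * iexp (u * (1 - p)) + complex_of_real (1 - p) * iexp (u * (- p))
      - complex_of_real (1 - u\<^sup>2 * (p * (1 - p)) / 2)) \<le> \<bar>u\<bar> ^ 3 / 6"
proof -
  define r where "r x = iexp x - (1 + \<i> * x - complex_of_real (x\<^sup>2 / 2))" for x :: real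
  have r: "cmod (r x) \<le> \<bar>x\<bar> ^ 3 / 6" for x
    using iexp_approx1[of x 2]
    by (simp add: r_def eval_nat_numeral power2_eq_square algebra_simps)
  have "complex_of_real p * iexp (u * (1 - p)) + complex_of_real (1 - p) * iexp (u * (- p))
      - complex_of_real (1 - u\<^sup>2 * (p * (1 - p)) / 2) =
      complex_of_real p * r (u * (1 - p)) + complex_of_real (1 - p) * r (u * (- p))"
    unfolding r_def by (simp add: field_simps power2_eq_square)
  also have "cmod \<dots> \<le> p * (\<bar>u\<bar> ^ 3 / 6) + (1 - p) * (\<bar>u\<bar> ^ 3 / 6)"
  proof -
    have le: "cmod (r (u * d)) \<le> \<bar>u\<bar> ^ 3 / 6" if "\<bar>d\<bar> \<le> 1" for d
    proof -
      have "\<bar>u * d\<bar> ^ 3 \<le> \<bar>u\<bar> ^ 3"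
        using that by (intro power_mono) (auto simp: abs_mult mult_left_le)
      then show ?thesis using r[of "u * d"] by linarith
    qed
    have "cmod (complex_of_real w * r (u * d)) \<le> w * (\<bar>u\<bar> ^ 3 / 6)" if "0 \<le> w" "\<bar>d\<bar> \<le> 1" for w d
      using mult_left_mono[OF le[OF that(2)] that(1)] that(1) by (simp add: norm_mult)
    from this[of p "1 - p"] this[of "1 - p" "- p"] show ?thesis
      using p by (intro norm_triangle_mono) auto
  qed
  also have "\<dots> = \<bar>u\<bar> ^ 3 / 6" by (simp flip: distrib_right)
  finally show ?thesis .
qed

lemma exp_minus_bound:
  fixes y :: real
  assumes "0 \<le> y"
  shows "\<bar>1 - y - exp (- y)\<bar> \<le> y\<^sup>2"
proof -
  have 1: "1 - y \<le> exp (- y)" using exp_ge_add_one_self[of "-y"] by simp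
  have "exp (- y) = inverse (exp y)" by (rule exp_minus)
  also have "\<dots> \<le> inverse (1 + y)"
    using assms exp_ge_add_one_self[of y] by (intro le_imp_inverse_le) auto
  also have "\<dots> \<le> 1 - y + y\<^sup>2"
    using assms by (simp add: field_simps power2_eq_square)
  finally show ?thesis using 1 by simp
qed

text \<open>Lindeberg's replacement in Fourier form: compare factor by factor with the
  characteristic function of a Gaussian of the same variance. Both products have factors in the
  unit disc, so the errors add up, and each is of third order in \<open>u\<close>.\<close>

lemma poisson_binomial_char_bound:
  assumes q: "q \<in> {1..} \<rightarrow> {0..1}"
  shows "cmod (measure_pmf.expectation (poisson_binomial_pmf q n) (\<lambda>j. iexp (u * (real j - sum q {1..n})))
      - complex_of_real (exp (- (u\<^sup>2 * (\<Sum>i=1..n. q i * (1 - q i)) / 2))))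
    \<le> real n * (\<bar>u\<bar> ^ 3 / 6 + u ^ 4 / 4)"
proof -
  define z where "z i = complex_of_real (q i) * iexp (u * (1 - q i)) +
      complex_of_real (1 - q i) * iexp (u * (- q i))" for i
  define y where "y i = u\<^sup>2 * (q i * (1 - q i)) / 2" for i
  have q01: "0 \<le> q i" "q i \<le> 1" if "i \<in> {1..n}" for i using funcset_mem[OF q, of i] that by auto
  have y: "0 \<le> y i" "y i \<le> u\<^sup>2 / 2" if "i \<in> {1..n}" for i
    using q01[OF that] by (auto simp: y_def mult_le_one mult_left_le)
  have "exp (- (u\<^sup>2 * (\<Sum>i=1..n. q i * (1 - q i)) / 2)) = (\<Prod>i=1..n. exp (- y i))"
    by (simp add: exp_sum[symmetric] y_def sum_negf sum_distrib_left sum_divide_distrib)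
  then have "cmod (measure_pmf.expectation (poisson_binomial_pmf q n) (\<lambda>j. iexp (u * (real j - sum q {1..n})))
      - complex_of_real (exp (- (u\<^sup>2 * (\<Sum>i=1..n. q i * (1 - q i)) / 2)))) =
      cmod ((\<Prod>i=1..n. z i) - (\<Prod>i=1..n. complex_of_real (exp (- y i))))"
    using q by (subst poisson_binomial_char) (auto simp: z_def)
  also have "\<dots> \<le> (\<Sum>i=1..n. cmod (z i - complex_of_real (exp (- y i))))"
  proof (rule norm_prod_diff)
    fix i assume i: "i \<in> {1..n}"
    have "cmod (z i) \<le> q i + (1 - q i)"
      unfolding z_def using q01[OF i]
      by (intro norm_triangle_mono) (simp_all only: norm_mult norm_of_real norm_exp_i_times, auto)
    then show "cmod (z i) \<le> 1" by simp
    show "cmod (complex_of_real (exp (- y i))) \<le> 1"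
      using y[OF i] by simp
  qed
  also have "\<dots> \<le> (\<Sum>i=1..n. \<bar>u\<bar> ^ 3 / 6 + u ^ 4 / 4)"
  proof (rule sum_mono)
    fix i assume i: "i \<in> {1..n}"
    have "cmod (z i - complex_of_real (exp (- y i))) \<le>
        cmod (z i - complex_of_real (1 - y i)) + cmod (complex_of_real (1 - y i) - complex_of_real (exp (- y i)))"
      by (rule norm_diff_triangle_ineq[THEN order_trans[rotated]]) simp
    also have "cmod (z i - complex_of_real (1 - y i)) \<le> \<bar>u\<bar> ^ 3 / 6"
      unfolding z_def y_def using q01[OF i] by (rule bernoulli_char_bound)
    also have "cmod (complex_of_real (1 - y i) - complex_of_real (exp (- y i))) = \<bar>1 - y i - exp (- y i)\<bar>"
      by (simp only: of_real_diff[symmetric] norm_of_real)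
    also have "\<dots> \<le> (y i)\<^sup>2" using y(1)[OF i] by (rule exp_minus_bound)
    also have "\<dots> \<le> (u\<^sup>2 / 2)\<^sup>2" using y[OF i] by (intro power_mono)
    also have "\<dots> = u ^ 4 / 4" by (simp add: power_divide)
    finally show "cmod (z i - complex_of_real (exp (- y i))) \<le> \<bar>u\<bar> ^ 3 / 6 + u ^ 4 / 4" by simp
  qed
  also have "\<dots> = real n * (\<bar>u\<bar> ^ 3 / 6 + u ^ 4 / 4)" by simp
  finally show ?thesis .
qed

text \<open>The distribution function of \<open>(S\<^sub>n - E S\<^sub>n) / sqrt (n s)\<close>. The scaling uses the limiting
  variance rate \<open>s\<close> instead of the variance of \<open>S\<^sub>n\<close>, which might vanish for small \<open>n\<close>.\<close>

definition normalized_cdf :: "(nat \<Rightarrow> real) \<Rightarrow> real \<Rightarrow> nat \<Rightarrow> real \<Rightarrow> real" where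
  "normalized_cdf q s n x =
     measure_pmf.prob (poisson_binomial_pmf q n)
       {j. (real j - sum q {1..n}) / sqrt (real n * s) \<le> x}"

text \<open>At frequency \<open>u = t / sqrt (n s)\<close> the error of the previous bound is of order
  \<open>n * u ^ 3\<close>, hence \<open>1 / sqrt n\<close>, while the Gaussian exponent tends to \<open>t\<^sup>2 / 2\<close> by the
  assumption on the variances. Continuity of \<open>Phi\<close> turns weak convergence into convergence at
  every point.\<close>

lemma poisson_binomial_clt:
  assumes q: "q \<in> {1..} \<rightarrow> {0..1}" and s: "s > 0"
    and var: "(\<lambda>n. (\<Sum>i=1..n. q i * (1 - q i)) / real n) \<longlonglongrightarrow> s"
  shows "(\<lambda>n. normalized_cdf q s n x) \<longlonglongrightarrow> Phi x"
proof -
  define \<mu> where "\<mu> n = distr (measure_pmf (poisson_binomial_pmf q n)) borel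
    (\<lambda>j. (real j - sum q {1..n}) / sqrt (real n * s))" for n
  define V where "V n = (\<Sum>i=1..n. q i * (1 - q i))" for n
  have real: "real_distribution (\<mu> n)" for n
    unfolding \<mu>_def by (rule prob_space.real_distribution_distr) (auto intro: measure_pmf.prob_space_axioms)
  have "weak_conv_m \<mu> std_normal_distribution"
  proof (rule levy_continuity[OF real real_dist_normal_dist])
    fix t :: real
    let ?u = "\<lambda>n. t / sqrt (real n * s)"
    let ?g = "\<lambda>n. complex_of_real (exp (- ((?u n)\<^sup>2 * V n / 2)))"
    have rate: "(\<lambda>n. real n * (\<bar>?u n\<bar> ^ 3 / 6 + ?u n ^ 4 / 4)) \<longlonglongrightarrow> 0"
    proof -
      have 3: "(\<lambda>n. real n * inverse (sqrt (real n * s)) ^ 3) \<longlonglongrightarrow> 0"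
        using s by real_asymp
      have 4: "(\<lambda>n. real n * inverse (sqrt (real n * s)) ^ 4) \<longlonglongrightarrow> 0"
        using s by real_asymp
      have "real n * (\<bar>?u n\<bar> ^ 3 / 6 + ?u n ^ 4 / 4) =
          real n * inverse (sqrt (real n * s)) ^ 3 * (\<bar>t\<bar> ^ 3 / 6) +
          real n * inverse (sqrt (real n * s)) ^ 4 * (t ^ 4 / 4)" for n
      proof -
        have "\<bar>?u n\<bar> = \<bar>t\<bar> * inverse (sqrt (real n * s))" "?u n = t * inverse (sqrt (real n * s))"
          using s by (simp_all add: divide_inverse abs_mult)
        then show ?thesis by (simp only: power_mult_distrib) (simp add: distrib_left mult_ac)
      qed
      then show ?thesis
        using tendsto_add[OF tendsto_mult_left_zero[OF 3, of "\<bar>t\<bar> ^ 3 / 6"]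
            tendsto_mult_left_zero[OF 4, of "t ^ 4 / 4"]] by simp
    qed
    have "cmod (char (\<mu> n) t - ?g n) \<le> real n * (\<bar>?u n\<bar> ^ 3 / 6 + ?u n ^ 4 / 4)" for n
      using poisson_binomial_char_bound[of q n "?u n"] q
      by (simp add: char_def \<mu>_def integral_distr V_def)
    then have diff: "(\<lambda>n. char (\<mu> n) t - ?g n) \<longlonglongrightarrow> 0"
      by (intro Lim_null_comparison[OF always_eventually rate] allI)
    have "(\<lambda>n. V n / real n * (t\<^sup>2 / (2 * s))) \<longlonglongrightarrow> s * (t\<^sup>2 / (2 * s))"
      using var unfolding V_def by (intro tendsto_intros)
    then have "(\<lambda>n. (?u n)\<^sup>2 * V n / 2) \<longlonglongrightarrow> t\<^sup>2 / 2"
      using s by (simp add: power_divide mult_ac)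
    then have "?g \<longlonglongrightarrow> complex_of_real (exp (- (t\<^sup>2 / 2)))"
      by (intro tendsto_of_real tendsto_exp tendsto_minus)
    from tendsto_add[OF diff this]
    show "(\<lambda>n. char (\<mu> n) t) \<longlonglongrightarrow> char std_normal_distribution t"
      by (simp add: char_std_normal_distribution)
  qed
  moreover note isCont_Phi[of x]
  ultimately have "(\<lambda>n. cdf (\<mu> n) x) \<longlonglongrightarrow> Phi x"
    unfolding weak_conv_m_def weak_conv_def Phi_def by simp
  moreover have "cdf (\<mu> n) x = normalized_cdf q s n x" for n
    unfolding cdf_def \<mu>_def normalized_cdf_def
    by (subst measure_distr) (auto simp: vimage_def)
  ultimately show ?thesis by simp
qed

section \<open>Sums over break points as integrals\<close>

lemma normalized_cdf_eq_break_point: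
  assumes q: "q \<in> {1..} \<rightarrow> {0..1}" and s: "s > 0" and n: "n \<ge> 1"
    and k: "k \<in> {1..n}"
    and x: "x \<in> {(real k - 1 - sum q {1..n}) / sqrt (real n * s)..<(real k - sum q {1..n}) / sqrt (real n * s)}"
  shows "normalized_cdf q s n x = break_point (\<lambda>n k. q n) n k"
proof -
  have c: "sqrt (real n * s) > 0" using s n by simp
  have "{j. (real j - sum q {1..n}) / sqrt (real n * s) \<le> x} = {..<k}"
    using x c k by (auto simp: field_simps)
  then show ?thesis
    unfolding normalized_cdf_def using q k by (subst break_point_eq_poisson_binomial) auto
qed

text \<open>The distribution function is a step function: between the two atoms \<open>k - 1\<close> and \<open>k\<close> (after
  normalization) it equals the break point with index \<open>k\<close>, and outside all these intervals it
  is 0 or 1.\<close>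

lemma normalized_cdf_cases:
  assumes q: "q \<in> {1..} \<rightarrow> {0..1}" and s: "s > 0" and n: "n \<ge> 1"
  obtains (step) k where "k \<in> {1..n}"
      "x \<in> {(real k - 1 - sum q {1..n}) / sqrt (real n * s)..<(real k - sum q {1..n}) / sqrt (real n * s)}"
  | (outside) "normalized_cdf q s n x \<in> {0, 1}"
proof -
  define c where "c = sqrt (real n * s)"
  define m where "m = sum q {1..n}"
  have c: "c > 0" using s n by (simp add: c_def)
  \<comment> \<open>The largest integer value of \<open>S\<^sub>n\<close> whose normalization is at most \<open>x\<close>.\<close>
  define l where "l = \<lfloor>c * x + m\<rfloor>"
  have le_iff: "(real j - m) / c \<le> x \<longleftrightarrow> int j \<le> l" for j
    using c by (simp add: l_def le_floor_iff field_simps)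
  consider "l < 0" | "0 \<le> l" "l < int n" | "l \<ge> int n" by linarith
  then show thesis
  proof cases
    case 1
    then have "{j. (real j - m) / c \<le> x} = {}" unfolding le_iff by auto
    then have "normalized_cdf q s n x = 0" by (simp add: normalized_cdf_def c_def m_def)
    then show ?thesis using outside by simp
  next
    case 2
    have "real_of_int l \<le> c * x + m" "c * x + m < real_of_int l + 1"
      unfolding l_def by linarith+
    then have "x \<in> {(real (nat l + 1) - 1 - m) / c..<(real (nat l + 1) - m) / c}"
      using c 2 by (auto simp: field_simps)
    then show ?thesis
      using 2 unfolding c_def m_def by (intro step[of "nat l + 1"]) auto
  next
    case 3
    have "1 = measure_pmf.prob (poisson_binomial_pmf q n) {..<Suc n}"
      using break_point_eq_poisson_binomial[of q "Suc n" n] q break_point_last[of "\<lambda>n k. q n" n] by simp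
    also have "\<dots> \<le> measure_pmf.prob (poisson_binomial_pmf q n) {j. (real j - m) / c \<le> x}"
      unfolding le_iff using 3 by (intro measure_pmf.finite_measure_mono) auto
    finally have "1 \<le> normalized_cdf q s n x"
      unfolding normalized_cdf_def c_def m_def .
    then have "normalized_cdf q s n x = 1"
      unfolding normalized_cdf_def by (intro antisym measure_pmf.prob_le_1)
    then show ?thesis using outside by simp
  qed
qed

text \<open>Every step of the distribution function has length \<open>1 / sqrt (n s)\<close>, so the scaled sum over the
  break points is exactly, not just approximately, an integral over the line. The unbounded
  steps contribute nothing because \<open>f\<close> vanishes at 0 and 1.\<close>

lemma sum_break_points_eq_integral:
  fixes f :: "real \<Rightarrow> real"
  assumes q: "q \<in> {1..} \<rightarrow> {0..1}" and s: "s > 0" and n: "n \<ge> 1"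
    and f: "f 0 = 0" "f 1 = 0"
  shows "(\<Sum>k=1..n. f (break_point (\<lambda>n k. q n) n k)) / sqrt (real n * s) =
    (\<integral>x. f (normalized_cdf q s n x) \<partial>lborel)"
proof -
  define c where "c = sqrt (real n * s)"
  define m where "m = sum q {1..n}"
  define J where "J k = {(real k - 1 - m) / c..<(real k - m) / c}" for k
  let ?A = "break_point (\<lambda>n k. q n) n"
  have c: "c > 0" using s n by (simp add: c_def)
  have disj: "k = k'" if "x \<in> J k" "x \<in> J k'" for x k k'
    using that c by (simp add: J_def field_simps)
  have F: "normalized_cdf q s n x = ?A k" if "k \<in> {1..n}" "x \<in> J k" for x k
    using normalized_cdf_eq_break_point[OF q s n] that unfolding J_def c_def m_def by blast
  have eq: "f (normalized_cdf q s n x) = (\<Sum>k=1..n. indicator (J k) x * f (?A k))" for x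
  proof -
    consider k where "k \<in> {1..n}" "x \<in> J k" | "normalized_cdf q s n x \<in> {0, 1}" "\<forall>k\<in>{1..n}. x \<notin> J k"
      using normalized_cdf_cases[of q s n x] q s n unfolding J_def c_def m_def by blast
    then show ?thesis
    proof cases
      case (1 k)
      then have "(\<Sum>k=1..n. indicator (J k) x * f (?A k)) = (\<Sum>i=1..n. if i = k then f (?A k) else 0)"
        using disj by (intro sum.cong) (auto simp: indicator_def)
      then show ?thesis using 1 F by simp
    next
      case 2
      then show ?thesis using f by auto
    qed
  qed
  have len: "measure lborel (J k) = 1 / c" for k
    unfolding J_def using c by (subst measure_lborel_Ico) (auto simp: field_simps)
  have "emeasure lborel (J k) < \<infinity>" for k
    unfolding J_def by (rule emeasure_bounded_finite) simp
  then have "(\<integral>x. f (normalized_cdf q s n x) \<partial>lborel) = (\<Sum>k=1..n. \<integral>x. indicator (J k) x * f (?A k) \<partial>lborel)"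
    unfolding eq
    by (intro Bochner_Integration.integral_sum integrable_mult_left integrable_real_indicator)
      (auto simp: J_def)
  also have "\<dots> = (\<Sum>k=1..n. f (?A k)) / c"
    by (simp add: len sum_divide_distrib)
  finally show ?thesis by (simp add: c_def)
qed

text \<open>Dominated convergence. The dominating function comes from monotonicity: once the distribution
  function is below \<open>a\<close> at one point \<open>l\<close> and above \<open>b\<close> at one point \<open>r\<close>, the integrand
  vanishes outside \<open>{l..r}\<close>, so pointwise convergence at these two points controls both tails.\<close>

lemma scaled_sum_tendsto:
  fixes f :: "real \<Rightarrow> real"
  assumes q: "q \<in> {1..} \<rightarrow> {0..1}" and s: "s > 0"
    and var: "(\<lambda>n. (\<Sum>i=1..n. q i * (1 - q i)) / real n) \<longlonglongrightarrow> s"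
    and cont: "continuous_on UNIV f" and ab: "0 < a" "a \<le> b" "b < 1"
    and supp: "\<And>y. y \<notin> {a..b} \<Longrightarrow> f y = 0"
  shows "(\<lambda>n. (\<Sum>k=1..n. f (break_point (\<lambda>n k. q n) n k)) / sqrt (real n * s))
    \<longlonglongrightarrow> (\<integral>x. f (Phi x) \<partial>lborel)"
proof -
  let ?F = "normalized_cdf q s"
  note clt = poisson_binomial_clt[OF q s var]
  have mono: "mono (?F n)" for n
    unfolding normalized_cdf_def by (intro monoI measure_pmf.finite_measure_mono) auto
  obtain B where B: "\<And>y. \<bar>f y\<bar> \<le> B"
  proof -
    have "compact (f ` {a..b})"
      by (intro compact_continuous_image continuous_on_subset[OF cont]) auto
    then obtain B where "\<forall>z\<in>f ` {a..b}. norm z \<le> B"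
      using compact_imp_bounded bounded_iff by metis
    then have "\<bar>f y\<bar> \<le> max B 0" for y
      by (cases "y \<in> {a..b}") (use supp in \<open>auto simp: le_max_iff_disj\<close>)
    then show thesis by (rule that)
  qed
  have B0: "0 \<le> B" using B[of 0] by linarith
  define l where "l = Q a - 1"
  define r where "r = Q b + 1"
  have "Phi l < Phi (Q a)" "Phi (Q b) < Phi r" by (simp_all add: l_def r_def)
  then have lr: "Phi l < a" "b < Phi r" using ab by (simp_all add: Phi_Q)
  have "\<forall>\<^sub>F n in sequentially. ?F n l < a \<and> b < ?F n r"
    using order_tendstoD(2)[OF clt lr(1)] order_tendstoD(1)[OF clt lr(2)] by eventually_elim simp
  then obtain N where N: "\<And>n. n \<ge> N \<Longrightarrow> ?F n l < a \<and> b < ?F n r"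
    unfolding eventually_sequentially by blast
  have dom: "\<bar>f (?F n x)\<bar> \<le> B * indicator {l..r} x" if "n \<ge> N" for n x
  proof (cases "x \<in> {l..r}")
    case True
    then show ?thesis using B by simp
  next
    case False
    then have "?F n x < a \<or> b < ?F n x"
      using N[OF that] monoD[OF mono[of n], of x l] monoD[OF mono[of n], of r x] by auto
    then have "f (?F n x) = 0" by (intro supp) auto
    then show ?thesis using B0 by simp
  qed
  have fm [measurable]: "f \<in> borel_measurable borel"
    using cont by (rule borel_measurable_continuous_onI)
  have "(\<lambda>n. \<integral>x. f (?F (n + N) x) \<partial>lborel) \<longlonglongrightarrow> (\<integral>x. f (Phi x) \<partial>lborel)"
  proof (rule integral_dominated_convergence[where w="\<lambda>x. B * indicator {l..r} x"])
    show "(\<lambda>x. f (Phi x)) \<in> borel_measurable lborel"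
      using borel_measurable_mono[of Phi] strict_mono_Phi strict_mono_mono by measurable
    show "(\<lambda>x. f (?F (n + N) x)) \<in> borel_measurable lborel" for n
      using borel_measurable_mono[OF mono] by measurable
    show "AE x in lborel. (\<lambda>n. f (?F (n + N) x)) \<longlonglongrightarrow> f (Phi x)"
    proof (rule AE_I2)
      fix x
      have "isCont f (Phi x)" using cont by (simp add: continuous_on_eq_continuous_at)
      then show "(\<lambda>n. f (?F (n + N) x)) \<longlonglongrightarrow> f (Phi x)"
        by (rule isCont_tendsto_compose) (rule LIMSEQ_ignore_initial_segment[OF clt])
    qed
    show "integrable lborel (\<lambda>x. B * indicator {l..r} x)"
      by (intro integrable_mult_right integrable_real_indicator emeasure_bounded_finite) auto
  qed (use dom in auto)
  then have lim: "(\<lambda>n. \<integral>x. f (?F n x) \<partial>lborel) \<longlonglongrightarrow> (\<integral>x. f (Phi x) \<partial>lborel)"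
    by (rule LIMSEQ_offset)
  have f01: "f 0 = 0" "f 1 = 0" using ab by (auto intro!: supp)
  show ?thesis
  proof (rule Lim_transform_eventually[OF lim])
    show "\<forall>\<^sub>F n in sequentially. (\<integral>x. f (?F n x) \<partial>lborel) =
        (\<Sum>k=1..n. f (break_point (\<lambda>n k. q n) n k)) / sqrt (real n * s)"
      using eventually_ge_at_top[of 1]
      by eventually_elim (use sum_break_points_eq_integral[OF q s _ f01] in simp)
  qed
qed

section \<open>The measures in the theorem\<close>

lemma integral_scale_measure:
  fixes f :: "'a \<Rightarrow> real"
  assumes [measurable]: "f \<in> borel_measurable M" and "r \<ge> 0"
  shows "(\<integral>x. f x \<partial>scale_measure (ennreal r) M) = r * (\<integral>x. f x \<partial>M)"
proof -
  have "scale_measure (ennreal r) M = density M (\<lambda>_. ennreal r)"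
    by (rule measure_eqI) (auto simp: emeasure_density_const)
  then show ?thesis
    using assms by (simp add: integral_density)
qed

lemma sets_emp_break: "sets (emp_break p n) = sets (restrict_space borel {0<..<1})"
  unfolding emp_break_def by (rule sets_restrict_space_cong) simp

lemma integral_emp_break:
  fixes f :: "real \<Rightarrow> real"
  assumes [measurable]: "f \<in> borel_measurable borel"
    and supp: "\<And>x. x \<notin> {0<..<1} \<Longrightarrow> f x = 0"
  shows "(\<integral>x. f x \<partial>emp_break p n) = (\<Sum>k=1..n. f (break_point p n k)) / real n"
proof -
  have m: "break_point p n \<in> measurable (uniform_count_measure {1..n}) borel"
    by (simp add: measurable_def space_uniform_count_measure sets_uniform_count_measure
        Pow_def vimage_def subset_iff)
  have "(\<integral>x. f x \<partial>emp_break p n) =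
      (\<integral>x. indicator {0<..<1} x *\<^sub>R f x \<partial>distr (uniform_count_measure {1..n}) borel (break_point p n))"
    unfolding emp_break_def by (rule integral_restrict_space) simp
  also have "(\<lambda>x. indicator {0<..<1} x *\<^sub>R f x) = f"
    using supp by (auto simp: fun_eq_iff indicator_def)
  also have "(\<integral>x. f x \<partial>distr (uniform_count_measure {1..n}) borel (break_point p n)) =
      (\<Sum>k=1..n. f (break_point p n k)) / real n"
    by (subst integral_distr[OF m assms(1)]) (simp add: integral_uniform_count_measure)
  finally show ?thesis .
qed

lemma radon_scaled_emp_break:
  "radon_measure_on {0<..<1} (scale_measure (ennreal (sqrt (real n) / r)) (emp_break p n))"
  unfolding radon_measure_on_def
proof (intro conjI allI impI)
  fix K :: "real set" assume K: "compact K \<and> K \<subseteq> {0<..<1}"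
  show "emeasure (scale_measure (ennreal (sqrt (real n) / r)) (emp_break p n)) K < \<infinity>"
  proof (cases "n = 0")
    case False
    then have "emeasure (emp_break p n) K < \<infinity>"
      using K by (subst emeasure_emp_break) (auto intro: borel_compact)
    then show ?thesis by (simp add: ennreal_mult_less_top)
  qed simp
qed (simp add: sets_emp_break)

lemma borel_measurable_deriv_Q:
  "deriv Q \<in> borel_measurable (restrict_space lborel {0<..<1})"
  using borel_measurable_continuous_on_restrict[OF continuous_on_deriv_Q]
  by (simp add: measurable_def space_restrict_space sets_restrict_space)

lemma radon_density_deriv_Q:
  "radon_measure_on {0<..<1} (density (restrict_space lborel {0<..<1}) (\<lambda>x. ennreal (deriv Q x)))"
  unfolding radon_measure_on_def
proof (intro conjI allI impI)
  show "sets (density (restrict_space lborel {0<..<1}) (\<lambda>x. ennreal (deriv Q x))) =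
      sets (restrict_space borel {0<..<1})"
    unfolding sets_density by (rule sets_restrict_space_cong) simp
next
  fix K :: "real set" assume "compact K \<and> K \<subseteq> {0<..<1}"
  then have K: "compact K" "K \<subseteq> {0<..<1}" by auto
  let ?R = "restrict_space lborel {0<..<1::real}"
  note [measurable] = borel_measurable_deriv_Q
  have KR [measurable]: "K \<in> sets ?R"
    using K by (subst sets_restrict_space_iff) (auto intro: borel_compact)
  have "compact (deriv Q ` K)"
    using K by (intro compact_continuous_image continuous_on_subset[OF continuous_on_deriv_Q])
  then obtain B where B: "\<forall>z\<in>deriv Q ` K. norm z \<le> B"
    using compact_imp_bounded bounded_iff by metis
  have "emeasure (density ?R (\<lambda>x. ennreal (deriv Q x))) K = (\<integral>\<^sup>+x\<in>K. ennreal (deriv Q x) \<partial>?R)"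
    by (rule emeasure_density) auto
  also have "\<dots> \<le> (\<integral>\<^sup>+x. ennreal B * indicator K x \<partial>?R)"
    using B by (intro nn_integral_mono) (auto simp: indicator_def intro!: ennreal_leI)
  also have "\<dots> = ennreal B * emeasure ?R K"
    by (rule nn_integral_cmult_indicator) (rule KR)
  also have "emeasure ?R K = emeasure lborel K"
    using K by (subst emeasure_restrict_space) auto
  also have "ennreal B * emeasure lborel K < \<infinity>"
    using emeasure_compact_finite[OF K(1)] by (simp add: ennreal_mult_less_top)
  finally show "emeasure (density ?R (\<lambda>x. ennreal (deriv Q x))) K < \<infinity>" .
qed

lemma integral_density_deriv_Q:
  fixes f :: "real \<Rightarrow> real"
  assumes [measurable]: "f \<in> borel_measurable borel"
    and supp: "\<And>x. x \<notin> {0<..<1} \<Longrightarrow> f x = 0"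
  shows "(\<integral>x. f x \<partial>density (restrict_space lborel {0<..<1}) (\<lambda>x. ennreal (deriv Q x))) =
    (\<integral>x. f x * deriv Q x \<partial>lborel)"
proof -
  let ?R = "restrict_space lborel {0<..<1::real}"
  have f: "f \<in> borel_measurable ?R" by (rule measurable_restrict_space1) simp
  have "(\<integral>x. f x \<partial>density ?R (\<lambda>x. ennreal (deriv Q x))) = (\<integral>x. deriv Q x *\<^sub>R f x \<partial>?R)"
    using f borel_measurable_deriv_Q by (rule integral_density) (auto intro!: AE_I2 deriv_Q_nonneg simp: space_restrict_space)
  also have "\<dots> = (\<integral>x. indicator {0<..<1} x *\<^sub>R (deriv Q x *\<^sub>R f x) \<partial>lborel)"
    by (rule integral_restrict_space) simp
  also have "\<dots> = (\<integral>x. f x * deriv Q x \<partial>lborel)"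
    by (rule Bochner_Integration.integral_cong[OF refl]) (use supp in \<open>auto simp: indicator_def\<close>)
  finally show ?thesis .
qed

section \<open>Vague convergence\<close>

text \<open>A test function on \<open>(0, 1)\<close> with compact support extends by zero to a continuous function on
  the line that is supported in some \<open>{a..b}\<close> with \<open>0 < a\<close> and \<open>b < 1\<close>. Integrals do not notice
  the extension, as all the measures live on \<open>(0, 1)\<close>.\<close>

lemma vague_conv_on_unit_intervalI:
  fixes \<mu> :: "real measure"
  assumes radon: "\<And>n. radon_measure_on {0<..<1} (\<mu>s n)" "radon_measure_on {0<..<1} \<mu>"
    and lim: "\<And>(f :: real \<Rightarrow> real) a b. continuous_on UNIV f \<Longrightarrow> 0 < a \<Longrightarrow> a \<le> b \<Longrightarrow> b < 1 \<Longrightarrow>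
      (\<And>x. x \<notin> {a..b} \<Longrightarrow> f x = 0) \<Longrightarrow> (\<lambda>n. \<integral>x. f x \<partial>\<mu>s n) \<longlonglongrightarrow> (\<integral>x. f x \<partial>\<mu>)"
  shows "vague_conv_on {0<..<1} \<mu>s \<mu>"
  unfolding vague_conv_on_def
proof (intro conjI allI impI radon)
  fix f :: "real \<Rightarrow> real"
  let ?S = "{0<..<1::real}" and ?K = "closure {x \<in> {0<..<1}. f x \<noteq> 0}"
  assume "continuous_on ?S f \<and> compact ?K \<and> ?K \<subseteq> ?S"
  then have f: "continuous_on ?S f" and K: "compact ?K" "?K \<subseteq> ?S" by auto
  define g where "g x = (if x \<in> ?S then f x else 0)" for x
  have g0: "g x = 0" if "x \<notin> ?K" for x
    using that closure_subset[of "{x \<in> {0<..<1}. f x \<noteq> 0}"] by (auto simp: g_def)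
  have "continuous_on (?S \<union> - ?K) g"
  proof (rule continuous_on_open_Un)
    show "continuous_on ?S g"
      using f by (rule continuous_on_eq) (simp add: g_def)
    show "continuous_on (- ?K) g"
      by (rule continuous_on_eq[of _ "\<lambda>_. 0"]) (auto simp: g0)
  qed auto
  moreover have "?S \<union> - ?K = UNIV" using K by auto
  ultimately have cont: "continuous_on UNIV g" by simp
  obtain a b where ab: "0 < a" "a \<le> b" "b < 1" "?K \<subseteq> {a..b}"
  proof (cases "?K = {}")
    case True
    have "?K \<subseteq> {1/2..1/2}" unfolding True by (rule empty_subsetI)
    then show ?thesis by (intro that[of "1/2" "1/2"]) simp_all
  next
    case False
    obtain a where a: "a \<in> ?K" "\<forall>x\<in>?K. a \<le> x" using compact_attains_inf[OF K(1) False] by blast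
    obtain b where b: "b \<in> ?K" "\<forall>x\<in>?K. x \<le> b" using compact_attains_sup[OF K(1) False] by blast
    have "0 < a" "b < 1" using a(1) b(1) K(2) by auto
    then show ?thesis using a b by (intro that[of a b]) auto
  qed
  have eq: "(\<integral>x. f x \<partial>\<nu>) = (\<integral>x. g x \<partial>\<nu>)" if "radon_measure_on ?S \<nu>" for \<nu>
  proof -
    have "space \<nu> = ?S"
      using that sets_eq_imp_space_eq[of \<nu> "restrict_space borel ?S"]
      by (simp add: radon_measure_on_def space_restrict_space)
    then show ?thesis by (intro Bochner_Integration.integral_cong) (auto simp: g_def)
  qed
  have "(\<lambda>n. \<integral>x. g x \<partial>\<mu>s n) \<longlonglongrightarrow> (\<integral>x. g x \<partial>\<mu>)"
    by (rule lim[OF cont ab(1-3)]) (use ab(4) g0 in blast)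
  then show "(\<lambda>n. \<integral>x. f x \<partial>\<mu>s n) \<longlonglongrightarrow> (\<integral>x. f x \<partial>\<mu>)"
    by (simp add: eq radon)
qed

text \<open>The deterministic core: only the average variance of the trials has to converge, so
  randomness of the proportions enters the theorem solely through the law of large numbers.\<close>

lemma vague_conv_emp_break:
  assumes q: "q \<in> {1..} \<rightarrow> {0..1}" and s: "s > 0"
    and var: "(\<lambda>n. (\<Sum>i=1..n. q i * (1 - q i)) / real n) \<longlonglongrightarrow> s"
  shows "vague_conv_on {0<..<1}
    (\<lambda>n. scale_measure (ennreal (sqrt (real n) / sqrt s)) (emp_break (\<lambda>n k. q n) n))
    (density (restrict_space lborel {0<..<1}) (\<lambda>x. ennreal (deriv Q x)))"
proof (rule vague_conv_on_unit_intervalI[OF radon_scaled_emp_break radon_density_deriv_Q])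
  fix f :: "real \<Rightarrow> real" and a b
  assume cont: "continuous_on UNIV f" and ab: "0 < a" "a \<le> b" "b < 1"
    and supp: "\<And>x. x \<notin> {a..b} \<Longrightarrow> f x = 0"
  have fm: "f \<in> borel_measurable borel" using cont by (rule borel_measurable_continuous_onI)
  have supp': "f x = 0" if "x \<notin> {0<..<1}" for x using that ab by (intro supp) auto
  let ?\<mu> = "\<lambda>n. scale_measure (ennreal (sqrt (real n) / sqrt s)) (emp_break (\<lambda>n k. q n) n)"
  have "(\<integral>x. f x \<partial>?\<mu> n) = (\<Sum>k=1..n. f (break_point (\<lambda>n k. q n) n k)) / sqrt (real n * s)" for n
  proof -
    have "f \<in> borel_measurable (emp_break (\<lambda>n k. q n) n)"
      using measurable_restrict_space1[OF fm, of "{0<..<1}"]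
      by (simp add: measurable_cong_sets[OF sets_emp_break refl])
    moreover have "(\<integral>x. f x \<partial>emp_break (\<lambda>n k. q n) n) =
        (\<Sum>k=1..n. f (break_point (\<lambda>n k. q n) n k)) / real n"
      by (rule integral_emp_break[OF fm]) (rule supp')
    ultimately have "(\<integral>x. f x \<partial>?\<mu> n) = sqrt (real n) / sqrt s *
        ((\<Sum>k=1..n. f (break_point (\<lambda>n k. q n) n k)) / real n)"
      using s by (simp only: integral_scale_measure
          divide_nonneg_nonneg real_sqrt_ge_zero less_imp_le of_nat_0_le_iff)
    also have "\<dots> = (\<Sum>k=1..n. f (break_point (\<lambda>n k. q n) n k)) / sqrt (real n * s)"
      \<comment> \<open>For \<open>n = 0\<close> both sides are 0, the left one since \<open>sqrt 0 = 0\<close>.\<close>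
      using s by (cases "n = 0") (auto simp: real_sqrt_mult field_simps)
    finally show ?thesis .
  qed
  moreover have "(\<integral>x. f x \<partial>density (restrict_space lborel {0<..<1}) (\<lambda>x. ennreal (deriv Q x))) =
      (\<integral>x. f (Phi x) \<partial>lborel)"
  proof -
    have "(\<integral>x. f x \<partial>density (restrict_space lborel {0<..<1}) (\<lambda>x. ennreal (deriv Q x))) =
        (\<integral>x. f x * deriv Q x \<partial>lborel)"
      by (rule integral_density_deriv_Q[OF fm]) (rule supp')
    also have "\<dots> = (\<integral>x. f (Phi x) \<partial>lborel)"
      by (rule integral_compose_Phi[symmetric, OF cont ab]) (rule supp)
    finally show ?thesis .
  qed
  ultimately show "(\<lambda>n. \<integral>x. f x \<partial>?\<mu> n) \<longlonglongrightarrow>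
      (\<integral>x. f x \<partial>density (restrict_space lborel {0<..<1}) (\<lambda>x. ennreal (deriv Q x)))"
    using scaled_sum_tendsto[OF q s var cont ab] supp by simp
qed

theorem theorem4p4:
  fixes M :: "'a measure" and P :: "nat \<Rightarrow> 'a \<Rightarrow> real" and s :: real
  assumes "prob_space M"
    and indep: "prob_space.indep_vars M (\<lambda>_. borel) P {1..}"
    and ident: "\<And>n. n \<ge> 1 \<Longrightarrow> distr M borel (P n) = distr M borel (P 1)"
    and range: "\<And>n \<omega>. n \<ge> 1 \<Longrightarrow> \<omega> \<in> space M \<Longrightarrow> P n \<omega> \<in> {0..1}"
    and s_def: "s = (\<integral>\<omega>. P 1 \<omega> * (1 - P 1 \<omega>) \<partial>M)"
    and nondeg: "\<P>(\<omega> in M. P 1 \<omega> \<in> {0<..<1}) > 0"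
  shows "AE \<omega> in M. vague_conv_on {0<..<1}
           (\<lambda>n. scale_measure (ennreal (sqrt (real n) / sqrt s)) (emp_break (\<lambda>n k. P n \<omega>) n))
           (density (restrict_space lborel {0<..<1}) (\<lambda>x. ennreal (deriv Q x)))"
proof -
  interpret prob_space M by fact
  have meas: "P n \<in> borel_measurable M" if "n \<ge> 1" for n
    using indep that unfolding indep_vars_def by auto
  note [measurable] = meas[OF order_refl]
  define X where "X n \<omega> = P n \<omega> * (1 - P n \<omega>)" for n \<omega>
  have X01: "X n \<omega> \<in> {0..1}" if "n \<ge> 1" "\<omega> \<in> space M" for n \<omega>
    using range[OF that] by (auto simp: X_def mult_le_one)
  have X_meas [measurable]: "X 1 \<in> borel_measurable M" unfolding X_def by measurable
  have slln: "AE \<omega> in M. (\<lambda>n. (\<Sum>i=1..n. X i \<omega>) / real n) \<longlonglongrightarrow> expectation (X 1)"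
  proof (rule strong_law_bounded_iid[where a=0 and b=1])
    show "indep_vars (\<lambda>_. borel) X {1..}"
      unfolding X_def by (rule indep_vars_compose2[OF indep]) auto
    show "distr M borel (X n) = distr M borel (X 1)" if "n \<ge> 1" for n
    proof -
      have law: "distr M borel (X k) = distr (distr M borel (P k)) borel (\<lambda>x. x * (1 - x))" if "k \<ge> 1" for k
        using meas[OF that] by (subst distr_distr) (auto simp: X_def[abs_def] comp_def)
      show ?thesis by (simp only: law[OF that] law[OF order_refl] ident[OF that])
    qed
    show "AE \<omega> in M. X 1 \<omega> \<in> {0..1}" by (rule AE_I2) (rule X01, simp)
  qed simp
  \<comment> \<open>\<open>X 1\<close> is nonnegative and vanishes only where \<open>P 1\<close> is 0 or 1, which is not almost sure.\<close>
  have "expectation (X 1) > 0"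
  proof -
    have int: "integrable M (X 1)"
      using X01[of 1] X_meas by (intro integrable_const_bound[where B=1]) auto
    have nonneg: "AE \<omega> in M. 0 \<le> X 1 \<omega>" using X01[of 1] by (intro AE_I2) auto
    have "expectation (X 1) \<noteq> 0"
    proof
      assume "expectation (X 1) = 0"
      then have "AE \<omega> in M. X 1 \<omega> = 0"
        using integral_nonneg_eq_0_iff_AE[OF int nonneg] by simp
      then have "AE \<omega> in M. P 1 \<omega> \<notin> {0<..<1}"
        by eventually_elim (auto simp: X_def)
      then have "AE \<omega> in M. \<omega> \<notin> {\<omega> \<in> space M. P 1 \<omega> \<in> {0<..<1}}"
        by eventually_elim simp
      then have "\<P>(\<omega> in M. P 1 \<omega> \<in> {0<..<1}) = 0"
        by (subst prob_eq_0) measurable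
      with nondeg show False by simp
    qed
    then show ?thesis using integral_nonneg_AE[OF nonneg] by simp
  qed
  moreover have mean: "expectation (X 1) = s" unfolding s_def X_def ..
  ultimately have s: "s > 0" by simp
  show ?thesis
    using slln AE_space
  proof eventually_elim
    case (elim \<omega>)
    show ?case
    proof (rule vague_conv_emp_break[OF _ s])
      show "(\<lambda>i. P i \<omega>) \<in> {1..} \<rightarrow> {0..1}" using range elim(2) by blast
      show "(\<lambda>n. (\<Sum>i=1..n. P i \<omega> * (1 - P i \<omega>)) / real n) \<longlonglongrightarrow> s"
        using elim(1) unfolding mean by (simp only: X_def)
    qed
  qed
qed

end
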